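(* Let $p$ be a prime, and let $r$ be a non-negative integer. The set $\mathcal{P}_{p,r}^{(0)}$ forms an abelian group under component-wise multiplication and zero-reduction modulo $p$, $\cdot_p^{(0)}$.
   Context: A partition is a finite weakly decreasing sequence $\lambda=(\lambda_1,\dots,\lambda_\ell)$ of positive integers; the empty partition $\emptyset$ is allowed; $\ell(\lambda)=\ell$ is its length; by convention $\lambda_j=0$ for $j>\ell(\lambda)$. For a positive integer $k$ and non-negative integer $r$, $\mathcal{P}_{k,r}^{(0)}$ is the set of partitions of length $r$ with no parts divisible by $k$, where the difference between any two consecutive parts is less than $k$ and the smallest part is less than $k$. Component-wise reduction modulo $k$ sends a partition $\lambda=(\lambda_1,\dots,\lambda_\ell)$ to $\lambda'=(\lambda_1',\dots,\lambda_\ell')$ (trailing zeros omitted; $\emptyset\mapsto\emptyset$), where $\lambda_\ell'=\lambda_\ell-\lfloor\lambda_\ell/k\rfloor k$ and, recursively for $j=\ell-1,\dots,1$, $\lambda_j'=\lambda_j-\left\lfloor(\lambda_j-\lambda_{j+1}')/k\right\rfloor k$. Component-wise zero-reduction modulo $k$ sends a partition having some part divisible by $k$ to $\emptyset$, and sends a partition with no part divisible by $k$ to its component-wise reduction modulo $k$. For partitions $\lambda,\pi$, $\lambda\cdot_k^{(0)}\pi$ is the component-wise zero-reduction modulo $k$ of the partition $(\lambda_1\pi_1,\lambda_2\pi_2,\dots,\lambda_i\pi_i)$, where $i=\min\{\ell(\lambda),\ell(\pi)\}$. *)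

theory Defs
  imports "HOL-Algebra.Group" "HOL-Computational_Algebra.Primes"
begin

definition is_partition :: "nat list \<Rightarrow> bool" where
  "is_partition xs \<longleftrightarrow> sorted_wrt (\<ge>) xs \<and> (\<forall>x\<in>set xs. 0 < x)"

text \<open>Parts are weakly decreasing, so the smallest part is the last one; for the empty
  partition the conditions on parts are vacuous.\<close>

definition P0 :: "nat \<Rightarrow> nat \<Rightarrow> nat list set" where
  "P0 k r = {xs. is_partition xs \<and> length xs = r \<and>
     (\<forall>x\<in>set xs. \<not> k dvd x) \<and>
     (\<forall>j. Suc j < length xs \<longrightarrow> xs ! j - xs ! Suc j < k) \<and>
     (xs \<noteq> [] \<longrightarrow> last xs < k)}"

text \<open>The components of the reduction, computed from the last one backwards. On partitions the
  truncated subtractions are exact, since every reduced component is at most the original one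
  and so \<open>hd zs \<le> y \<le> x\<close>; hence \<open>div\<close> is the floor of the rational quotient.\<close>

fun reduce_parts :: "nat \<Rightarrow> nat list \<Rightarrow> nat list" where
  "reduce_parts k [] = []"
| "reduce_parts k [x] = [x - (x div k) * k]"
| "reduce_parts k (x # y # ys) =
     (let zs = reduce_parts k (y # ys) in (x - ((x - hd zs) div k) * k) # zs)"

definition strip_zeros :: "nat list \<Rightarrow> nat list" where
  "strip_zeros xs = rev (dropWhile (\<lambda>x. x = 0) (rev xs))"

definition reduction :: "nat \<Rightarrow> nat list \<Rightarrow> nat list" where
  "reduction k xs = strip_zeros (reduce_parts k xs)"

definition zero_reduction :: "nat \<Rightarrow> nat list \<Rightarrow> nat list" where
  "zero_reduction k xs = (if \<exists>x\<in>set xs. k dvd x then [] else reduction k xs)"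

text \<open>\<open>map2\<close> truncates to the shorter of the two lists.\<close>

definition zero_mult :: "nat \<Rightarrow> nat list \<Rightarrow> nat list \<Rightarrow> nat list" where
  "zero_mult k xs ys = zero_reduction k (map2 (*) xs ys)"

end

theory Submission
  imports Defs "HOL-Number_Theory.Cong"
begin

text \<open>A partition in \<open>P0 p r\<close> is determined by its residues modulo \<open>p\<close>: reading from the last part,
  each part is the unique number with the given residue in a window of length \<open>p\<close> starting at the
  following part. All vectors of nonzero residues occur, and \<open>zero_mult p\<close> is multiplication of
  residue vectors, so \<open>P0 p r\<close> is a copy of the \<open>r\<close>-th power of the group of units modulo \<open>p\<close>.\<close>

text \<open>The value 0 on the empty list follows the convention that parts beyond the length are
  zero. It turns the bound on the smallest part into a case of the bound on consecutive
  differences.\<close>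

definition hd0 :: "nat list \<Rightarrow> nat" where
  "hd0 xs = (case xs of [] \<Rightarrow> 0 | x # _ \<Rightarrow> x)"

lemma hd0_simps [simp]: "hd0 [] = 0" "hd0 (x # xs) = x"
  by (simp_all add: hd0_def)

lemma P0_0 [simp]: "P0 k 0 = {[]}"
  by (auto simp: P0_def is_partition_def)

lemma length_P0: "xs \<in> P0 k r \<Longrightarrow> length xs = r"
  by (simp add: P0_def)

lemma not_dvd_P0: "xs \<in> P0 k r \<Longrightarrow> x \<in> set xs \<Longrightarrow> \<not> k dvd x"
  by (simp add: P0_def)

lemma decreasing_P0: "xs \<in> P0 k r \<Longrightarrow> sorted_wrt (\<ge>) xs"
  by (simp add: P0_def is_partition_def)

text \<open>Recursive description on which the inductions rest: a new first part is constrained only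
  by its residue and by the window of length \<open>k\<close> starting at
  \<open>hd0 xs\<close>.\<close>

lemma P0_Cons_iff:
  "x # xs \<in> P0 k (Suc r) \<longleftrightarrow> xs \<in> P0 k r \<and> \<not> k dvd x \<and> hd0 xs \<le> x \<and> x < hd0 xs + k"
proof (cases xs)
  case Nil
  then show ?thesis
    by (auto simp: P0_def is_partition_def intro: Nat.gr0I)
next
  case (Cons y ys)
  have all_Suc: "(\<forall>j. Q j) \<longleftrightarrow> Q 0 \<and> (\<forall>j. Q (Suc j))" for Q
    by (metis not0_implies_Suc)
  have diffs: "(\<forall>j. Suc j < length (x # y # ys) \<longrightarrow> (x # y # ys) ! j - (x # y # ys) ! Suc j < k) \<longleftrightarrow>
      x - y < k \<and> (\<forall>j. Suc j < length (y # ys) \<longrightarrow> (y # ys) ! j - (y # ys) ! Suc j < k)"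
    by (subst all_Suc) simp
  have part: "is_partition (x # y # ys) \<longleftrightarrow> 0 < x \<and> y \<le> x \<and> is_partition (y # ys)"
    by (auto simp: is_partition_def)
  show ?thesis
    unfolding Cons P0_def mem_Collect_eq diffs part
    by (auto intro: Nat.gr0I)
qed

lemma P0_SucE:
  assumes "xs \<in> P0 k (Suc r)"
  obtains y ys where "xs = y # ys" "ys \<in> P0 k r" "\<not> k dvd y" "hd0 ys \<le> y" "y < hd0 ys + k"
  using assms by (cases xs) (auto simp: P0_Cons_iff dest: length_P0)

text \<open>Subtracting \<open>z\<close> moves both numbers below \<open>k\<close>, where congruent
  numbers coincide.\<close>

lemma cong_window_unique:
  fixes x y z k :: nat
  assumes "[x = y] (mod k)" "z \<le> x" "x < z + k" "z \<le> y" "y < z + k"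
  shows "x = y"
proof -
  have "[(x - z) + z = (y - z) + z] (mod k)"
    using assms by simp
  then have "[x - z = y - z] (mod k)"
    by (simp only: cong_add_rcancel_nat)
  then have "x - z = y - z"
    by (rule cong_less_modulus_unique_nat) (use assms in auto)
  then show ?thesis
    using assms by simp
qed

text \<open>Once the tails agree, both first parts lie in the same window and have the same
  residue.\<close>

lemma P0_eqI:
  assumes "xs \<in> P0 k r" "ys \<in> P0 k r" "map (\<lambda>x. x mod k) xs = map (\<lambda>x. x mod k) ys"
  shows "xs = ys"
  using assms
proof (induction r arbitrary: xs ys)
  case (Suc r)
  from Suc.prems(1) obtain x xs' where x: "xs = x # xs'" "xs' \<in> P0 k r" "hd0 xs' \<le> x" "x < hd0 xs' + k"
    by (rule P0_SucE)
  from Suc.prems(2) obtain y ys' where y: "ys = y # ys'" "ys' \<in> P0 k r" "hd0 ys' \<le> y" "y < hd0 ys' + k"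
    by (rule P0_SucE)
  have "xs' = ys'"
    using Suc.IH Suc.prems(3) x y by simp
  moreover from this have "x = y"
    using Suc.prems(3) x y by (intro cong_window_unique[of x y k "hd0 xs'"]) (auto simp: cong_def)
  ultimately show ?case
    using x y by simp
qed simp

text \<open>The parts are built from the last one on: every window of length \<open>k\<close>
  contains each residue.\<close>

lemma ex_P0_residues:
  assumes "0 < k" "\<forall>a\<in>set as. \<not> k dvd a"
  shows "\<exists>xs \<in> P0 k (length as). map (\<lambda>x. x mod k) xs = map (\<lambda>a. a mod k) as"
  using assms(2)
proof (induction as)
  case (Cons a as)
  then obtain xs where xs: "xs \<in> P0 k (length as)" "map (\<lambda>x. x mod k) xs = map (\<lambda>a. a mod k) as"
    by auto
  define z where "z = hd0 xs"
  \<comment> \<open>Modulo \<open>k\<close>, \<open>(k - 1) * z\<close> stands for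
    \<open>- z\<close>, so the offset from \<open>z\<close> is the residue of \<open>a - z\<close>
    without truncated subtraction.\<close>
  define x where "x = z + (a + (k - 1) * z) mod k"
  have "x mod k = (a + (z + (k - 1) * z)) mod k"
    by (simp add: x_def mod_add_right_eq ac_simps)
  also have "z + (k - 1) * z = k * z"
    using \<open>0 < k\<close> by (cases k) auto
  finally have "x mod k = a mod k"
    by simp
  moreover from this have "\<not> k dvd x"
    using Cons.prems by (metis dvd_eq_mod_eq_0 list.set_intros(1))
  moreover have "z \<le> x" "x < z + k"
    using \<open>0 < k\<close> by (simp_all add: x_def)
  ultimately show ?case
    using xs by (intro bexI[of _ "x # xs"]) (auto simp: P0_Cons_iff z_def)
qed simp

lemma reduce_parts_Cons:
  "reduce_parts k (x # xs) =
     (x - (x - hd0 (reduce_parts k xs)) div k * k) # reduce_parts k xs"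
  by (cases xs; cases "tl xs") (simp_all add: Let_def)

text \<open>Each reduced part is the representative of its residue in the window above the reduced
  tail. The last conjunct strengthens the induction: with the ordering of \<open>xs\<close> it makes
  the subtraction \<open>x - hd0 zs\<close> exact.\<close>

lemma reduce_parts_P0:
  assumes "0 < k" "sorted_wrt (\<ge>) xs" "\<forall>x\<in>set xs. \<not> k dvd x"
  shows "reduce_parts k xs \<in> P0 k (length xs) \<and>
    map (\<lambda>x. x mod k) (reduce_parts k xs) = map (\<lambda>x. x mod k) xs \<and>
    hd0 (reduce_parts k xs) \<le> hd0 xs"
  using assms(2,3)
proof (induction xs)
  case (Cons x xs)
  define zs where "zs = reduce_parts k xs"
  define x' where "x' = x - (x - hd0 zs) div k * k"
  have IH: "zs \<in> P0 k (length xs)" "map (\<lambda>x. x mod k) zs = map (\<lambda>x. x mod k) xs"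
    "hd0 zs \<le> hd0 xs"
    using Cons by (auto simp: zs_def)
  have "hd0 xs \<le> x"
    using Cons.prems by (cases xs) auto
  then have "hd0 zs \<le> x"
    using IH(3) by simp
  moreover have "(x - hd0 zs) div k * k + (x - hd0 zs) mod k = x - hd0 zs"
    by simp
  \<comment> \<open>Removing the multiple of \<open>k\<close> leaves the remainder as offset, which
    gives both the window bounds and the residue.\<close>
  ultimately have x': "x' = hd0 zs + (x - hd0 zs) mod k"
    unfolding x'_def by linarith
  then have "x' mod k = x mod k"
    using \<open>hd0 zs \<le> x\<close> by (simp add: mod_add_right_eq)
  moreover from this have "\<not> k dvd x'"
    using Cons.prems by (metis dvd_eq_mod_eq_0 list.set_intros(1))
  moreover have "hd0 zs \<le> x'" "x' < hd0 zs + k"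
    using \<open>0 < k\<close> by (simp_all add: x')
  moreover have "x' \<le> x"
    by (simp add: x'_def)
  ultimately show ?case
    using IH by (simp add: reduce_parts_Cons P0_Cons_iff flip: zs_def x'_def)
qed simp

text \<open>Every \<open>k\<close> divides 0, so no part is zero and the length is kept.\<close>

lemma strip_zeros_P0:
  assumes "xs \<in> P0 k r"
  shows "strip_zeros xs = xs"
proof (cases xs rule: rev_cases)
  case (snoc ys y)
  then have "y \<noteq> 0"
    using not_dvd_P0[OF assms, of y] by (intro notI) simp
  then show ?thesis
    by (simp add: snoc strip_zeros_def)
qed (simp add: strip_zeros_def)

lemma sorted_wrt_ge_map2_mult:
  fixes xs ys :: "nat list"
  assumes "sorted_wrt (\<ge>) xs" "sorted_wrt (\<ge>) ys"
  shows "sorted_wrt (\<ge>) (map2 (*) xs ys)"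
  using assms by (auto simp: sorted_wrt_iff_nth_less intro: mult_le_mono)

text \<open>By primality no product of parts is divisible by \<open>p\<close>, so
  \<open>zero_reduction\<close> never falls into its empty case; equal lengths keep
  \<open>map2\<close> from truncating.\<close>

lemma
  assumes "prime p" "xs \<in> P0 p r" "ys \<in> P0 p r"
  shows zero_mult_closed: "zero_mult p xs ys \<in> P0 p r"
    and zero_mult_residues:
      "map (\<lambda>x. x mod p) (zero_mult p xs ys) = map2 (\<lambda>x y. x * y mod p) xs ys"
proof -
  let ?zs = "map2 (*) xs ys"
  have len: "length ?zs = r"
    using assms by (simp add: length_P0)
  have nd: "\<forall>z\<in>set ?zs. \<not> p dvd z"
  proof
    fix z assume "z \<in> set ?zs"
    then obtain x y where "z = x * y" "x \<in> set xs" "y \<in> set ys"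
      by (auto dest: set_zip_leftD set_zip_rightD)
    then show "\<not> p dvd z"
      using assms by (simp add: prime_dvd_mult_iff not_dvd_P0)
  qed
  have "0 < p"
    using assms(1) by (rule prime_gt_0_nat)
  note red = reduce_parts_P0[OF this sorted_wrt_ge_map2_mult nd,
      OF assms(2,3)[THEN decreasing_P0], unfolded len]
  have "zero_mult p xs ys = reduce_parts p ?zs"
    using nd red strip_zeros_P0 unfolding zero_mult_def zero_reduction_def reduction_def by auto
  then show "zero_mult p xs ys \<in> P0 p r"
      "map (\<lambda>x. x mod p) (zero_mult p xs ys) = map2 (\<lambda>x y. x * y mod p) xs ys"
    using red by (simp_all add: case_prod_unfold)
qed

lemma zero_mult_nth_cong:
  assumes "prime p" "xs \<in> P0 p r" "ys \<in> P0 p r" "i < r"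
  shows "[zero_mult p xs ys ! i = xs ! i * ys ! i] (mod p)"
proof -
  have "map (\<lambda>x. x mod p) (zero_mult p xs ys) ! i = map2 (\<lambda>x y. x * y mod p) xs ys ! i"
    using assms by (simp only: zero_mult_residues)
  then show ?thesis
    using assms zero_mult_closed[OF assms(1-3)] by (simp add: length_P0 cong_def)
qed

lemma P0_nth_eqI:
  assumes "xs \<in> P0 k r" "ys \<in> P0 k r" "\<And>i. i < r \<Longrightarrow> [xs ! i = ys ! i] (mod k)"
  shows "xs = ys"
  using assms by (intro P0_eqI[OF assms(1,2)] nth_equalityI) (auto simp: length_P0 cong_def)

lemma ex_P0_nth:
  assumes "0 < k" "\<And>i. i < r \<Longrightarrow> \<not> k dvd f i"
  obtains xs where "xs \<in> P0 k r" "\<And>i. i < r \<Longrightarrow> [xs ! i = f i] (mod k)"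
proof -
  obtain xs where xs: "xs \<in> P0 k r" "map (\<lambda>x. x mod k) xs = map (\<lambda>a. a mod k) (map f [0..<r])"
    using ex_P0_residues[of k "map f [0..<r]"] assms by auto
  have "[xs ! i = f i] (mod k)" if "i < r" for i
    using that arg_cong[OF xs(2), of "\<lambda>l. l ! i"] length_P0[OF xs(1)] by (simp add: cong_def)
  with xs(1) show ?thesis
    by (rule that)
qed

theorem theorem5:
  fixes p r :: nat
  assumes "prime p"
  shows "\<exists>e. comm_group \<lparr>carrier = P0 p r, monoid.mult = zero_mult p, monoid.one = e\<rparr>"
proof -
  note closed = zero_mult_closed[OF assms, where r = r]
    and nth = zero_mult_nth_cong[OF assms, where r = r]
    and eqI = P0_nth_eqI[where k = p and r = r]
  have "0 < p"
    using assms by (rule prime_gt_0_nat)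
  have "\<not> p dvd 1"
    using assms by (auto dest: not_prime_unit)
  \<comment> \<open>The identity is chosen by its residues; it is the list of \<open>r\<close>
    ones.\<close>
  with \<open>0 < p\<close> obtain e where e: "e \<in> P0 p r" "\<And>i. i < r \<Longrightarrow> [e ! i = 1] (mod p)"
    using ex_P0_nth[of p r "\<lambda>_. 1"] by metis
  \<comment> \<open>Each group law is checked index by index modulo \<open>p\<close> and lifted to
    lists by \<open>eqI\<close>.\<close>
  have assoc: "zero_mult p (zero_mult p xs ys) zs = zero_mult p xs (zero_mult p ys zs)"
    if "xs \<in> P0 p r" "ys \<in> P0 p r" "zs \<in> P0 p r" for xs ys zs
  proof (rule eqI)
    fix i assume i: "i < r"
    have "[zero_mult p (zero_mult p xs ys) zs ! i = zero_mult p xs ys ! i * zs ! i] (mod p)"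
      by (intro nth closed that i)
    also have "[zero_mult p xs ys ! i * zs ! i = (xs ! i * ys ! i) * zs ! i] (mod p)"
      by (intro cong_scalar_right nth that i)
    also have "(xs ! i * ys ! i) * zs ! i = xs ! i * (ys ! i * zs ! i)"
      by (rule mult.assoc)
    also have "[xs ! i * (ys ! i * zs ! i) = xs ! i * zero_mult p ys zs ! i] (mod p)"
      by (intro cong_scalar_left cong_sym[OF nth] that i)
    also have "[xs ! i * zero_mult p ys zs ! i = zero_mult p xs (zero_mult p ys zs) ! i] (mod p)"
      by (intro cong_sym[OF nth] closed that i)
    finally show "[zero_mult p (zero_mult p xs ys) zs ! i =
        zero_mult p xs (zero_mult p ys zs) ! i] (mod p)" .
  qed (intro closed that)+
  have comm: "zero_mult p xs ys = zero_mult p ys xs" if "xs \<in> P0 p r" "ys \<in> P0 p r" for xs ys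
  proof (rule eqI)
    fix i assume i: "i < r"
    show "[zero_mult p xs ys ! i = zero_mult p ys xs ! i] (mod p)"
      using nth[OF that i] cong_sym[OF nth[OF that(2,1) i]]
      unfolding mult.commute[of "ys ! i"] by (rule cong_trans)
  qed (intro closed that)+
  have one: "zero_mult p e xs = xs" if "xs \<in> P0 p r" for xs
  proof (rule eqI)
    fix i assume i: "i < r"
    have "[zero_mult p e xs ! i = e ! i * xs ! i] (mod p)"
      by (intro nth e that i)
    also have "[e ! i * xs ! i = 1 * xs ! i] (mod p)"
      by (intro cong_scalar_right e i)
    finally show "[zero_mult p e xs ! i = xs ! i] (mod p)"
      by simp
  qed (intro closed that e)+
  have inverse: "\<exists>ys \<in> P0 p r. zero_mult p ys xs = e" if xs: "xs \<in> P0 p r" for xs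
  proof -
    have "\<exists>y. [xs ! i * y = 1] (mod p)" if "i < r" for i
    proof -
      have "\<not> p dvd xs ! i"
        using not_dvd_P0[OF xs] that length_P0[OF xs] by simp
      then have "coprime (xs ! i) p"
        using prime_imp_coprime[OF assms] coprime_commute by blast
      then show ?thesis
        using cong_solve_coprime_nat by simp
    qed
    then obtain f where f: "[xs ! i * f i = 1] (mod p)" if "i < r" for i
      by metis
    \<comment> \<open>If \<open>p\<close> divided \<open>f i\<close>, it would divide a product
      congruent to 1. Hence the inverse residues are realised by a list in
      \<open>P0 p r\<close>.\<close>
    have "\<not> p dvd f i" if "i < r" for i
      using cong_dvd_iff[OF f[OF that]] \<open>\<not> p dvd 1\<close> by auto
    with \<open>0 < p\<close> obtain ys where ys: "ys \<in> P0 p r" "\<And>i. i < r \<Longrightarrow> [ys ! i = f i] (mod p)"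
      using ex_P0_nth[of p r f] by metis
    have "zero_mult p ys xs = e"
    proof (rule eqI)
      fix i assume i: "i < r"
      have "[zero_mult p ys xs ! i = ys ! i * xs ! i] (mod p)"
        by (intro nth xs ys i)
      also have "[ys ! i * xs ! i = f i * xs ! i] (mod p)"
        by (intro cong_scalar_right ys i)
      also have "f i * xs ! i = xs ! i * f i"
        by (rule mult.commute)
      also have "[xs ! i * f i = 1] (mod p)"
        by (rule f[OF i])
      also have "[1 = e ! i] (mod p)"
        by (intro cong_sym[OF e(2)] i)
      finally show "[zero_mult p ys xs ! i = e ! i] (mod p)" .
    qed (intro closed xs ys e)+
    with ys(1) show ?thesis
      by (rule bexI[rotated])
  qed
  have "comm_group \<lparr>carrier = P0 p r, monoid.mult = zero_mult p, monoid.one = e\<rparr>"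
    \<comment> \<open>Given commutativity, a left identity and left inverses suffice.\<close>
    by (rule comm_groupI; unfold partial_object.simps monoid.simps;
        intro closed e assoc comm one inverse)
  then show ?thesis
    by (rule exI)
qed

end
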